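(* Let $q$ be an odd prime power and let $\gamma\in\mathbb{F}_{q^2}$. The polynomial $f(x)=x+\gamma\,\mathrm{Tr}\left(x^3-x^{q+2}\right)$ over $\mathbb{F}_{q^2}$ is a permutation polynomial if and only if $\gamma\in\mathbb{F}_q$ and $-2\gamma$ is a square of $\mathbb{F}_q$.
   Context: $\mathrm{Tr}:\mathbb{F}_{q^2}\to\mathbb{F}_q$ is the trace map $\mathrm{Tr}(x)=x+x^q$. A polynomial $f$ over $\mathbb{F}_{q^2}$ is a permutation polynomial if the map $x\mapsto f(x)$ is a bijection of $\mathbb{F}_{q^2}$ onto itself. An element $a\in\mathbb{F}_q$ is a square of $\mathbb{F}_q$ if $a=s^2$ for some $s\in\mathbb{F}_q$ (so $0$ is a square). *)

theory Defs
  imports "HOL-Computational_Algebra.Computational_Algebra" "HOL-Number_Theory.Prime_Powers"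
    "HOL-Library.Cardinality"
begin

definition is_subfield :: "'a::field set \<Rightarrow> bool" where
  "is_subfield K \<longleftrightarrow> 0 \<in> K \<and> 1 \<in> K \<and>
     (\<forall>x\<in>K. \<forall>y\<in>K. x + y \<in> K \<and> x * y \<in> K) \<and>
     (\<forall>x\<in>K. - x \<in> K \<and> inverse x \<in> K)"

(* The formula of the trace from the field with q^2 elements to its subfield with q elements.
   The type is a general commutative semiring so that the same formula also applies to a
   polynomial p, giving p + p^q; see poly_Tr. *)
definition Tr :: "nat \<Rightarrow> 'a::comm_semiring_1 \<Rightarrow> 'a" where
  "Tr q x = x + x ^ q"

lemma poly_Tr: "poly (Tr q p) x = Tr q (poly p x)" for x :: "'a::comm_semiring_1"
  by (simp add: Tr_def)

definition permutation_polynomial :: "'a::comm_semiring_0 poly \<Rightarrow> bool" where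
  "permutation_polynomial f \<longleftrightarrow> bij (poly f)"

end

theory Submission
  imports Defs
begin

text \<open>
  Write \<open>y = x\<^sup>q\<close>. The trace factors as \<open>Tr (x\<^sup>3 - x\<^bsup>q+2\<^esup>) = (x - y)\<^sup>2 (x + y)\<close>.
  It vanishes on the subfield, so for \<open>\<gamma>\<close> outside the subfield one can solve a linear equation for
  \<open>x\<close> in the subfield such that \<open>x + \<gamma>\<close> has trace value \<open>-1\<close>; then \<open>f (x + \<gamma>) = x = f x\<close>.
  For \<open>\<gamma>\<close> in the subfield, \<open>f\<close> preserves \<open>\<delta> = x - y\<close> and multiplies \<open>x + y\<close> by
  \<open>1 + 2 \<gamma> \<delta>\<^sup>2\<close>. Writing \<open>-2 \<gamma> = s\<^sup>2\<close> in the large field, this factor has a zero with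
  \<open>\<delta>\<^sup>q = -\<delta>\<close> precisely when \<open>s\<close> is not in the subfield.
\<close>

section \<open>Finite fields and their subfields\<close>

text \<open>Translation by 1 permutes the ring, so the sum of all elements is unchanged when 1 is
  added to each.\<close>

lemma of_nat_CARD_eq_0: "of_nat CARD('a) = (0 :: 'a::{ring_1,finite})"
proof -
  have "(\<Sum>x\<in>UNIV. x + 1) = (\<Sum>x\<in>UNIV. x :: 'a)"
    by (rule sum.reindex_bij_witness[of _ "\<lambda>x. x - 1" "\<lambda>x. x + 1"]) auto
  then show ?thesis
    by (simp add: sum.distrib)
qed

text \<open>Since \<open>CARD('a)\<close> vanishes in the field, the characteristic, a prime,
  divides \<open>p ^ n\<close>.\<close>

lemma CHAR_eq_of_CARD_prime_power:
  assumes "prime p" and "CARD('a::{field,finite}) = p ^ n"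
  shows "CHAR('a) = p"
proof -
  have "CHAR('a) dvd p ^ n"
    using of_nat_CARD_eq_0[where 'a = 'a] assms(2) by (metis of_nat_eq_0_iff_char_dvd)
  moreover have "prime CHAR('a)"
    by (intro prime_CHAR_semidom finite_imp_CHAR_pos) simp
  ultimately show ?thesis
    using assms(1) by (metis prime_dvd_power primes_dvd_imp_eq)
qed

text \<open>Multiplication by a nonzero \<open>x\<close> permutes \<open>K - {0}\<close>; comparing
  the products over \<open>K - {0}\<close> gives Fermat's identity.\<close>

lemma subfield_power_card:
  fixes K :: "'a::field set"
  assumes "is_subfield K" and "finite K" and "x \<in> K"
  shows "x ^ card K = x"
proof -
  have "0 \<in> K"
    using assms(1) by (simp add: is_subfield_def)
  then have card: "card K = Suc (card (K - {0}))"
    using assms(2) by (metis card_Suc_Diff1)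
  show ?thesis
  proof (cases "x = 0")
    case False
    have mult: "a * b \<in> K" and inv: "inverse a \<in> K" if "a \<in> K" "b \<in> K" for a b
      using assms(1) that by (auto simp: is_subfield_def)
    have "(\<Prod>y\<in>K - {0}. x * y) = \<Prod>(K - {0})"
      by (rule prod.reindex_bij_witness[of _ "\<lambda>y. inverse x * y" "\<lambda>y. x * y"])
        (use False assms(3) in \<open>auto intro!: mult inv\<close>)
    moreover have "(\<Prod>y\<in>K - {0}. x * y) = x ^ card (K - {0}) * \<Prod>(K - {0})"
      by (simp add: prod.distrib)
    moreover have "\<Prod>(K - {0}) \<noteq> 0"
      using assms(2) by simp
    ultimately show ?thesis
      by (simp add: card)
  qed (simp add: card)
qed

lemma degree_monom_minus_lower:
  fixes r :: "'a::comm_ring_1 poly"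
  assumes "degree r < n"
  shows "degree (monom 1 n - r) = n" and "monom 1 n - r \<noteq> 0"
proof -
  have "coeff (monom 1 n - r) n = 1"
    using assms by (simp add: coeff_eq_0)
  then show "monom 1 n - r \<noteq> 0"
    by force
  show "degree (monom 1 n - r) = n"
    using \<open>coeff (monom 1 n - r) n = 1\<close> assms
    by (intro antisym degree_diff_le le_degree) (auto simp: degree_monom_le)
qed

text \<open>Every element of \<open>K\<close> is a root of \<open>X^n - X\<close> with
  \<open>n = card K\<close>, which has at most \<open>n\<close> roots. This turns membership in
  \<open>Fq\<close> into \<open>x ^ q = x\<close>.\<close>

lemma subfield_eq_fixed_points:
  fixes K :: "'a::field set"
  assumes "is_subfield K" and "finite K"
  shows "K = {x. x ^ card K = x}"
proof -
  let ?p = "monom 1 (card K) - monom 1 1 :: 'a poly"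
  have "{0, 1} \<subseteq> K"
    using assms(1) by (simp add: is_subfield_def)
  then have "card {0 :: 'a, 1} \<le> card K"
    using assms(2) by (intro card_mono)
  then have "1 < card K"
    by simp
  then have p: "degree ?p = card K" "?p \<noteq> 0"
    by (intro degree_monom_minus_lower; simp add: degree_monom_eq)+
  have roots: "{x. poly ?p x = 0} = {x. x ^ card K = x}"
    by (simp add: poly_monom)
  show ?thesis
  proof (rule card_seteq)
    show "finite {x :: 'a. x ^ card K = x}"
      using poly_roots_finite[OF p(2)] unfolding roots .
    show "K \<subseteq> {x. x ^ card K = x}"
      using subfield_power_card[OF assms] by blast
    show "card {x :: 'a. x ^ card K = x} \<le> card K"
      using card_poly_roots_bound[OF p(2)] unfolding roots p(1) .
  qed
qed

section \<open>Squares in finite fields\<close>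

text \<open>Squaring is at most two-to-one, since only \<open>x\<close> and \<open>- x\<close> have
  the square \<open>x\<^sup>2\<close>.\<close>

lemma card_le_twice_card_squares:
  fixes A :: "'a::idom set"
  assumes "finite A"
  shows "card A \<le> 2 * card (power2 ` A)"
proof -
  let ?F = "\<lambda>y. {x \<in> A. x\<^sup>2 = y}"
  have fibre: "card (?F y) \<le> 2" if "y \<in> power2 ` A" for y
  proof -
    obtain x where "y = x\<^sup>2"
      using \<open>y \<in> power2 ` A\<close> by blast
    then have "?F y \<subseteq> {x, - x}"
      by (auto simp: power2_eq_iff)
    then have "card (?F y) \<le> card {x, - x}"
      by (intro card_mono) auto
    also have "\<dots> \<le> 2"
      by (simp add: card_insert_if)
    finally show ?thesis .
  qed
  have "A = (\<Union>y\<in>power2 ` A. ?F y)"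
    by auto
  then have "card A \<le> (\<Sum>y\<in>power2 ` A. card (?F y))"
    using card_UN_le[of "power2 ` A" ?F] assms by simp
  also have "\<dots> \<le> (\<Sum>y\<in>power2 ` A. 2)"
    by (intro sum_mono fibre)
  finally show ?thesis
    by simp
qed

text \<open>Half of Euler's criterion: the nonzero squares are roots of \<open>X^m - 1\<close>, and
  there are at least \<open>m\<close> of them, so they are all of its roots.\<close>

lemma finite_field_square_if_power_half_eq_1:
  fixes u :: "'a::{field,finite}"
  assumes "CARD('a) = Suc (2 * m)" and "u ^ m = 1"
  shows "\<exists>s. u = s\<^sup>2"
proof -
  let ?U = "UNIV - {0 :: 'a}"
  let ?p = "monom 1 m - 1 :: 'a poly"
  have "is_subfield (UNIV :: 'a set)"
    by (simp add: is_subfield_def)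
  then have fermat: "x ^ Suc (2 * m) = x" for x :: 'a
    using subfield_power_card[of UNIV x] assms(1) by simp
  have "card {0 :: 'a, 1} \<le> CARD('a)"
    by (intro card_mono) auto
  then have "0 < m"
    using assms(1) by simp
  then have p: "degree ?p = m" "?p \<noteq> 0"
    by (intro degree_monom_minus_lower; simp)+
  have roots: "{x. poly ?p x = 0} = {x. x ^ m = 1}"
    by (simp add: poly_monom)
  have "power2 ` ?U = {x. x ^ m = 1}"
  proof (rule card_seteq)
    show "power2 ` ?U \<subseteq> {x. x ^ m = 1}"
    proof safe
      fix x :: 'a
      assume "x \<noteq> 0"
      then have "x ^ (2 * m) = 1"
        using fermat[of x] by simp
      then show "(x\<^sup>2) ^ m = 1"
        by (simp add: power_mult)
    qed
    have "card ?U = 2 * m"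
      using assms(1) by simp
    then have "m \<le> card (power2 ` ?U)"
      using card_le_twice_card_squares[of ?U] by simp
    then show "card {x :: 'a. x ^ m = 1} \<le> card (power2 ` ?U)"
      using card_poly_roots_bound[OF p(2)] unfolding roots p(1) by simp
  qed simp
  then show ?thesis
    using assms(2) by blast
qed

theorem theorem3p6:
  fixes q :: nat and Fq :: "'a::{field,finite} set" and \<gamma> :: 'a
  assumes "primepow q" and "odd q"
    and "CARD('a) = q\<^sup>2"
    and "is_subfield Fq" and "card Fq = q"
  shows "permutation_polynomial
           (monom 1 1 + smult \<gamma> (Tr q (monom 1 3 - monom 1 (q + 2))))
         \<longleftrightarrow> \<gamma> \<in> Fq \<and> (\<exists>s\<in>Fq. - 2 * \<gamma> = s\<^sup>2)"
proof -
  obtain p k where "prime p" and q: "q = p ^ k"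
    using assms(1) by (auto simp: primepow_def)
  then have "CHAR('a) = p"
    using assms(3) by (intro CHAR_eq_of_CARD_prime_power[of p "k * 2"]) (auto simp: power_mult)
  \<comment> \<open>As \<open>q\<close> is a power of the characteristic, the conjugation
    \<open>x ^ q\<close> is an iterated Frobenius map. The prefix \<open>c_\<close> marks its
    rules.\<close>
  then have c_add: "(x + y) ^ q = x ^ q + y ^ q" for x y :: 'a
    using freshmans_dream'[where 'a = 'a] \<open>prime p\<close> q by simp
  have c_minus: "(- x) ^ q = - (x ^ q)" for x :: 'a
    using assms(2) by simp
  have c_diff: "(x - y) ^ q = x ^ q - y ^ q" for x y :: 'a
    using c_add[of x "- y"] c_minus by simp
  have c_c: "(x ^ q) ^ q = x" for x :: 'a
    using subfield_power_card[of UNIV x] assms(3)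
    by (simp add: is_subfield_def power2_eq_square flip: power_mult)
  have Fq_iff: "x \<in> Fq \<longleftrightarrow> x ^ q = x" for x
    using subfield_eq_fixed_points[OF assms(4)] assms(5) by auto
  have two: "(2 :: 'a) \<noteq> 0"
  proof
    assume "(2 :: 'a) = 0"
    then have "(of_nat (2 * (q\<^sup>2 div 2) + 1) :: 'a) = 1"
      by simp
    also have "2 * (q\<^sup>2 div 2) + 1 = CARD('a)"
      using assms(2,3) by simp
    finally show False
      by (metis of_nat_CARD_eq_0 zero_neq_one)
  qed
  have c_two: "(2 :: 'a) ^ q = 2"
    using c_add[of 1 1] by simp
  have neg_eq: "x = 0" if "x = - x" for x :: 'a
    using that two by (metis add.right_inverse mult_2 mult_eq_0_iff)

  define f where "f x = x + \<gamma> * ((x - x ^ q)\<^sup>2 * (x + x ^ q))" for x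
  \<comment> \<open>With \<open>y = x ^ q\<close>, conjugation turns \<open>x^3 - x^2 y\<close> into
    \<open>y^3 - y^2 x\<close>; the two sum to \<open>(x - y) (x^2 - y^2)\<close>.\<close>
  have "poly (monom 1 1 + smult \<gamma> (Tr q (monom 1 3 - monom 1 (q + 2)))) x = f x" for x
    by (simp add: poly_Tr Tr_def poly_monom f_def c_diff power_add
        power2_eq_square power3_eq_cube c_c algebra_simps)
  then have "poly (monom 1 1 + smult \<gamma> (Tr q (monom 1 3 - monom 1 (q + 2)))) = f"
    by (rule ext)
  then have perm: "permutation_polynomial
      (monom 1 1 + smult \<gamma> (Tr q (monom 1 3 - monom 1 (q + 2)))) \<longleftrightarrow> inj f"
    unfolding permutation_polynomial_def bij_def by (metis finite_UNIV_inj_surj finite)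

  \<comment> \<open>Necessity of \<gamma> lying in the subfield\<close>
  have "\<gamma> \<in> Fq" if "inj f"
  proof (rule ccontr)
    assume "\<gamma> \<notin> Fq"
    define \<delta> where "\<delta> = \<gamma> - \<gamma> ^ q"
    have "\<delta> \<noteq> 0"
      using \<open>\<gamma> \<notin> Fq\<close> by (simp add: \<delta>_def Fq_iff)
    have c_\<delta>: "\<delta> ^ q = - \<delta>"
      by (simp add: \<delta>_def c_diff c_c)
    \<comment> \<open>The solution of
      \<open>\<delta>\<^sup>2 * (2 * x + \<gamma> + \<gamma> ^ q) = - 1\<close>; it is fixed by
      conjugation because \<open>\<delta>\<^sup>2\<close> and \<open>\<gamma> + \<gamma> ^ q\<close>
      are.\<close>
    define x where "x = (- 1 / \<delta>\<^sup>2 - (\<gamma> + \<gamma> ^ q)) / 2"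
    have "(\<delta>\<^sup>2) ^ q = \<delta>\<^sup>2"
      using c_\<delta> by (metis mult.commute power2_minus power_mult)
    then have c_x: "x ^ q = x"
      by (simp add: x_def c_diff c_add c_minus c_c c_two power_divide add.commute)
    have "\<delta>\<^sup>2 * (2 * x + \<gamma> + \<gamma> ^ q) = - 1"
      using \<open>\<delta> \<noteq> 0\<close> two by (simp add: x_def field_simps)
    moreover have "f (x + \<gamma>) = x + \<gamma> + \<gamma> * (\<delta>\<^sup>2 * (2 * x + \<gamma> + \<gamma> ^ q))"
      by (simp add: f_def c_add c_x \<delta>_def algebra_simps)
    ultimately have "f (x + \<gamma>) = x"
      by simp
    moreover have "f x = x"
      by (simp add: f_def c_x)
    ultimately have "\<gamma> = 0"
      using that by (metis add_cancel_right_right injD)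
    then show False
      using \<open>\<delta> \<noteq> 0\<close> assms(2) by (simp add: \<delta>_def odd_pos)
  qed

  \<comment> \<open>The square condition for \<gamma> in the subfield\<close>
  moreover have "inj f \<longleftrightarrow> (\<exists>s\<in>Fq. - 2 * \<gamma> = s\<^sup>2)" if "\<gamma> \<in> Fq"
  proof -
    have c_\<gamma>: "\<gamma> ^ q = \<gamma>"
      using that by (simp add: Fq_iff)
    show ?thesis
    proof
      assume "\<exists>s\<in>Fq. - 2 * \<gamma> = s\<^sup>2"
      then obtain s where c_s: "s ^ q = s" and s: "- 2 * \<gamma> = s\<^sup>2"
        by (auto simp: Fq_iff)
      \<comment> \<open>The term that \<open>f\<close> adds to \<open>x\<close> is fixed by
        conjugation, so it cancels in \<open>f x - f x ^ q\<close> and doubles in the sum.\<close>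
      have c_f: "f x ^ q = x ^ q + \<gamma> * ((x - x ^ q)\<^sup>2 * (x + x ^ q))" for x
      proof -
        have "((x - x ^ q)\<^sup>2) ^ q = ((x - x ^ q) ^ q)\<^sup>2"
          by (metis mult.commute power_mult)
        also have "\<dots> = (x - x ^ q)\<^sup>2"
          by (simp add: c_diff c_c power2_commute)
        finally show ?thesis
          by (simp add: f_def c_add c_\<gamma> power_mult_distrib c_c add.commute)
      qed
      have f_diff: "f x - f x ^ q = x - x ^ q" for x
        unfolding c_f by (simp add: f_def)
      have f_sum: "f x + f x ^ q = (1 - (s * (x - x ^ q))\<^sup>2) * (x + x ^ q)" for x
        unfolding c_f by (simp add: f_def power_mult_distrib flip: s) (simp add: algebra_simps)
      \<comment> \<open>A zero would make \<open>s * (x - x ^ q)\<close> equal to 1 or -1, hence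
        fixed by conjugation; but conjugation fixes \<open>s\<close> and negates
        \<open>x - x ^ q\<close>.\<close>
      have factor: "1 - (s * (x - x ^ q))\<^sup>2 \<noteq> 0" for x
      proof
        assume "1 - (s * (x - x ^ q))\<^sup>2 = 0"
        then have root: "s * (x - x ^ q) = 1 \<or> s * (x - x ^ q) = - 1"
          by (simp add: power2_eq_1_iff)
        then have "(s * (x - x ^ q)) ^ q = s * (x - x ^ q)"
          using assms(2) by auto
        moreover have "(s * (x - x ^ q)) ^ q = - (s * (x - x ^ q))"
          by (simp add: c_s c_diff c_c algebra_simps)
        ultimately have "s * (x - x ^ q) = 0"
          by (intro neg_eq) simp
        then show False
          using root by (metis neg_equal_0_iff_equal zero_neq_one)
      qed
      show "inj f"
      proof (rule injI)
        fix x y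
        assume "f x = f y"
        then have diff: "x - x ^ q = y - y ^ q"
          using f_diff by metis
        moreover have "x + x ^ q = y + y ^ q"
          using f_sum[of x] f_sum[of y] factor[of x] \<open>f x = f y\<close> by (simp add: diff)
        ultimately have "(x - x ^ q) + (x + x ^ q) = (y - y ^ q) + (y + y ^ q)"
          by simp
        then have "2 * x = 2 * y"
          by simp
        then show "x = y"
          using two by simp
      qed
    next
      assume "inj f"
      show "\<exists>s\<in>Fq. - 2 * \<gamma> = s\<^sup>2"
      proof (cases "\<gamma> = 0")
        case True
        then show ?thesis
          using assms(4) by (intro bexI[of _ 0]) (auto simp: is_subfield_def)
      next
        case False
        define u where "u = - 2 * \<gamma>"
        have "u \<noteq> 0"
          using False two by (simp add: u_def)
        have c_u: "u ^ q = u"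
          by (simp add: u_def power_mult_distrib c_minus c_two c_\<gamma>)
        obtain r where r: "q = Suc (2 * r)"
          using assms(2) by (metis oddE Suc_eq_plus1)
        have "u ^ (2 * r) = 1"
          using c_u \<open>u \<noteq> 0\<close> by (simp add: r)
        \<comment> \<open>The Euler exponent of the large field,
          \<open>(q^2 - 1) / 2 = 2 r (r + 1)\<close>, is a multiple of \<open>q - 1 = 2 r\<close>,
          so \<open>u\<close> has a square root there.\<close>
        then have "u ^ (2 * r * Suc r) = 1"
          by (metis power_mult power_one)
        moreover have "CARD('a) = Suc (2 * (2 * r * Suc r))"
          by (simp add: assms(3) r power2_eq_square)
        ultimately obtain s where s: "u = s\<^sup>2"
          using finite_field_square_if_power_half_eq_1 by blast
        have "(s ^ q)\<^sup>2 = s\<^sup>2"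
          using c_u unfolding s by (metis mult.commute power_mult)
        then consider "s ^ q = s" | "s ^ q = - s"
          by (auto simp: power2_eq_iff)
        then show ?thesis
        proof cases
          case 1
          then show ?thesis
            using s by (auto simp: Fq_iff u_def)
        next
          case 2
          have "s \<noteq> 0"
            using s \<open>u \<noteq> 0\<close> by auto
          \<comment> \<open>Both \<open>x\<close> and \<open>x + 1\<close> have difference
            \<open>2 * x = 1 / s\<close> from their conjugates, where the factor of the sum
            vanishes. Hence \<open>f\<close> cannot separate them.\<close>
          define x where "x = 1 / (2 * s)"
          have c_x: "x ^ q = - x"
            by (simp add: x_def power_divide power_mult_distrib c_two 2)
          have "\<gamma> * (2 * (2 * x)\<^sup>2) = - u * (2 * x)\<^sup>2"
            by (simp add: u_def)
          also have "\<dots> = - 1"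
            using two \<open>s \<noteq> 0\<close> by (simp add: s x_def power2_eq_square)
          finally have "f (x + 1) = x"
            by (simp add: f_def c_add c_x algebra_simps)
          moreover have "f x = x"
            by (simp add: f_def c_x)
          ultimately show ?thesis
            using \<open>inj f\<close> by (metis add_cancel_right_right injD zero_neq_one)
        qed
      qed
    qed
  qed
  ultimately show ?thesis
    unfolding perm by blast
qed

end
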